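(* Let $f:\mathbb{R}^n\to(-\infty,+\infty]$ be proper, closed and convex ($\mu_f=0$), let $g:\mathbb{R}^m\to(-\infty,+\infty]$ be proper, closed and strongly convex with parameter $\mu_g>0$, and let $A\in\mathbb{R}^{m\times n}$, $A\ne0$. Let $\{(x_{t+1},y_{t+1})\}$ be produced by EDPD (defined in the context) with $$\alpha_{t+1}=\frac{t+1}{t+2},\qquad \tau=\frac{2.5}{\mu_g},\qquad \tau_t=\frac{\tau}{t+1},\qquad \eta_t=\frac{t+1}{\tau\|A\|^2},\qquad y_0=y_1.$$ For $k\ge1$ define $$\tilde x_{k+1}=\frac{\sum_{t=1}^k(t+1)x_{t+1}}{\sum_{t=1}^k(t+1)},\qquad \tilde y_{k+1}=\frac{\sum_{t=1}^k(t+1)y_{t+1}}{\sum_{t=1}^k(t+1)},\qquad \tilde E_{k+1}=L(\tilde x_{k+1},y)-L(x,\tilde y_{k+1}).$$ Then for all $k\ge1$, $x\in X$ and $y\in Y$, $$\tilde E_{k+1}\le\frac{2}{k(k+3)}\left[\frac{\|A\|^2\tau}{2}\|x-x_1\|^2+\frac{2}{\tau}\|y-y_1\|^2\right].$$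
   Context: Saddle point problem: $\min_x\max_y L(x,y)$ with $L(x,y)=f(x)+\langle Ax,y\rangle-g(y)$. Norms are Euclidean, and $\|A\|$ is the operator norm. Put $X=\operatorname{dom} f$ and $Y=\operatorname{dom} g$ (the sets where $f$, $g$ are finite). A function $h$ is strongly convex with parameter $\mu\ge0$ if $h-\frac{\mu}{2}\|\cdot\|^2$ is convex. EDPD (exact method): given $x_1\in X$, $y_1\in Y$, parameters $\alpha_t\in\mathbb{R}$, $\tau_t>0$, $\eta_t>0$, set $\hat y_1=y_1$ (convention $y_0=y_1$), and for $t=1,2,\dots$ compute - $x_{t+1}=\arg\min_x\left\{f(x)+\langle Ax,\hat y_t\rangle+\frac{1}{2\eta_t}\|x-x_t\|^2\right\}$ (assumed to exist, automatic since the objective is strongly convex), - $y_{t+1}=\arg\min_y\left\{\frac{1}{2\tau_t}\|y-(y_t+\tau_tAx_{t+1})\|^2+g(y)\right\}$, - $\hat y_{t+1}=y_{t+1}+\alpha_{t+1}(y_{t+1}-y_t)$. *)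

theory Defs
  imports "HOL-Analysis.Analysis"
begin

definition effective_dom :: "('a \<Rightarrow> ereal) \<Rightarrow> 'a set" where
  "effective_dom h = {x. \<bar>h x\<bar> \<noteq> \<infinity>}"

definition proper_fun :: "('a \<Rightarrow> ereal) \<Rightarrow> bool" where
  "proper_fun h \<longleftrightarrow> (\<forall>x. h x \<noteq> -\<infinity>) \<and> (\<exists>x. h x \<noteq> \<infinity>)"

text \<open>
  The library constants \<open>epigraph\<close> and \<open>convex_on\<close> are restricted to real-valued functions,
  so convexity and closedness of extended-real-valued functions are expressed through the
  following epigraph, a subset of the real vector space \<open>'a \<times> real\<close>.
\<close>

definition ereal_epigraph :: "('a \<Rightarrow> ereal) \<Rightarrow> ('a \<times> real) set" where
  "ereal_epigraph h = {(x, r). h x \<le> ereal r}"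

definition closed_fun :: "('a::topological_space \<Rightarrow> ereal) \<Rightarrow> bool" where
  "closed_fun h \<longleftrightarrow> closed (ereal_epigraph h)"

definition convex_fun :: "('a::real_vector \<Rightarrow> ereal) \<Rightarrow> bool" where
  "convex_fun h \<longleftrightarrow> convex (ereal_epigraph h)"

definition strongly_convex_fun :: "real \<Rightarrow> ('a::real_normed_vector \<Rightarrow> ereal) \<Rightarrow> bool" where
  "strongly_convex_fun \<mu> h \<longleftrightarrow> 0 \<le> \<mu> \<and> convex_fun (\<lambda>x. h x - ereal (\<mu> / 2 * (norm x)\<^sup>2))"

definition saddle_fun ::
  "(real^'n \<Rightarrow> ereal) \<Rightarrow> (real^'m \<Rightarrow> ereal) \<Rightarrow> real^'n^'m \<Rightarrow> real^'n \<Rightarrow> real^'m \<Rightarrow> ereal" where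
  "saddle_fun f g A x y = f x + ereal ((A *v x) \<bullet> y) - g y"

text \<open>
  The sequences \<open>x\<close>, \<open>y\<close> and \<open>yh\<close> (the extrapolated dual points) are the iterates,
  indexed from 1; \<open>x 0\<close>, \<open>yh 0\<close> and all parameters with index 0 are never used, nor is
  \<open>\<alpha> 1\<close>; the convention \<open>y 0 = y 1\<close> enters no step. The minimisations range over the whole space, and each iterate is required to be a
  minimiser, so existence of minimisers is part of the assumption.
\<close>

definition EDPD ::
  "(real^'n \<Rightarrow> ereal) \<Rightarrow> (real^'m \<Rightarrow> ereal) \<Rightarrow> real^'n^'m \<Rightarrow>
   (nat \<Rightarrow> real) \<Rightarrow> (nat \<Rightarrow> real) \<Rightarrow> (nat \<Rightarrow> real) \<Rightarrow>
   (nat \<Rightarrow> real^'n) \<Rightarrow> (nat \<Rightarrow> real^'m) \<Rightarrow> (nat \<Rightarrow> real^'m) \<Rightarrow> bool" where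
  "EDPD f g A \<alpha> \<tau> \<eta> x y yh \<longleftrightarrow>
     x 1 \<in> effective_dom f \<and> y 1 \<in> effective_dom g \<and> y 0 = y 1 \<and> yh 1 = y 1 \<and>
     (\<forall>t\<ge>1. 0 < \<tau> t \<and> 0 < \<eta> t \<and>
        is_arg_min
          (\<lambda>u. f u + ereal ((A *v u) \<bullet> yh t) + ereal (1 / (2 * \<eta> t) * (norm (u - x t))\<^sup>2))
          (\<lambda>_. True) (x (t + 1)) \<and>
        is_arg_min
          (\<lambda>v. ereal (1 / (2 * \<tau> t) * (norm (v - (y t + \<tau> t *\<^sub>R (A *v x (t + 1)))))\<^sup>2) + g v)
          (\<lambda>_. True) (y (t + 1)) \<and>
        yh (t + 1) = y (t + 1) + \<alpha> (t + 1) *\<^sub>R (y (t + 1) - y t))"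

text \<open>
  \<open>ergodic_mean z k\<close> is the average carrying the index \<open>k + 1\<close> in the literature: it combines
  the iterates \<open>z 2, \<dots>, z (k + 1)\<close>.
\<close>

definition ergodic_mean :: "(nat \<Rightarrow> 'a::real_vector) \<Rightarrow> nat \<Rightarrow> 'a" where
  "ergodic_mean z k = (\<Sum>t=1..k. (real t + 1) *\<^sub>R z (t + 1)) /\<^sub>R (\<Sum>t=1..k. (real t + 1))"

end

theory Submission
  imports Defs
begin

text \<open>
  Write \<open>N\<close> for the operator norm of \<open>A\<close> and \<open>d\<^sub>t = y\<^sub>t - y\<^sub>t\<^sub>-\<^sub>1\<close>. The proof exhibits the potential
  \<open>\<Phi>\<^sub>t = \<tau> N\<^sup>2/2 \<parallel>x - x\<^sub>t\<parallel>\<^sup>2 + (t + 1)\<^sup>2/(2 \<tau>) \<parallel>y - y\<^sub>t\<parallel>\<^sup>2 + t\<^sup>2/(2 \<tau>) \<parallel>d\<^sub>t\<parallel>\<^sup>2 - t \<langle>A (x\<^sub>t - x), d\<^sub>t\<rangle>\<close>,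
  whose decrease pays for the weighted gap:
  \<open>(t + 1) (L(x\<^sub>t\<^sub>+\<^sub>1, y) - L(x, y\<^sub>t\<^sub>+\<^sub>1)) \<le> \<Phi>\<^sub>t - \<Phi>\<^sub>t\<^sub>+\<^sub>1\<close>.

  Adding the two optimality inequalities of a step leaves one bilinear term,
  \<open>\<langle>A (x\<^sub>t\<^sub>+\<^sub>1 - x), d\<^sub>t\<^sub>+\<^sub>1 - \<alpha>\<^sub>t d\<^sub>t\<rangle>\<close>. Because \<open>(t + 1) \<alpha>\<^sub>t = t\<close>, its weighted version telescopes up to
  \<open>t \<langle>A (x\<^sub>t\<^sub>+\<^sub>1 - x\<^sub>t), d\<^sub>t\<rangle>\<close>, which Young's inequality (\<open>coupling_le_squares\<close>) absorbs into the squares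
  \<open>\<parallel>x\<^sub>t\<^sub>+\<^sub>1 - x\<^sub>t\<parallel>\<^sup>2\<close> and \<open>\<parallel>d\<^sub>t\<parallel>\<^sup>2\<close>; the first comes from the primal step, the second from the previous
  dual step. The coefficient of \<open>\<parallel>y - y\<^sub>t\<parallel>\<^sup>2\<close> may grow from \<open>(t + 1)\<^sup>2\<close> to \<open>(t + 2)\<^sup>2\<close> (in units of
  \<open>1 / (2 \<tau>)\<close>) because strong convexity of \<open>g\<close> contributes \<open>\<mu>\<^sub>g \<tau> (t + 1) = 2.5 (t + 1)\<close>, and this is
  at least \<open>2 t + 3\<close> once \<open>t \<ge> 1\<close> (\<open>edpd_gap_le_potential_drop\<close>).

  The same Young inequality makes \<open>\<Phi>\<close> nonnegative (\<open>edpd_potential_nonneg\<close>), and \<open>\<Phi>\<^sub>1\<close> is exactly the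
  bracket of the claim since \<open>d\<^sub>1 = 0\<close>. Summing over \<open>t\<close> bounds the total weighted gap by \<open>\<Phi>\<^sub>1\<close>, and
  Jensen's inequality (\<open>ergodic_mean_Jensen\<close>) passes from the iterates to their weighted means, at the
  cost of the total weight \<open>k (k + 3) / 2\<close>.
\<close>

section \<open>Strongly convex extended-real-valued functions\<close>

lemma norm_convex_combination_sq:
  fixes p u :: "'a::real_inner"
  shows "(norm ((1 - s) *\<^sub>R p + s *\<^sub>R u))\<^sup>2
    = (1 - s) * (norm p)\<^sup>2 + s * (norm u)\<^sup>2 - s * (1 - s) * (norm (u - p))\<^sup>2"
  by (simp add: power2_norm_eq_inner inner_simps inner_commute algebra_simps)

text \<open>
  A convex combination of the epigraph points of \<open>h - \<mu>/2 \<parallel>\<cdot>\<parallel>\<^sup>2\<close> over \<open>p\<close> and \<open>u\<close> lies in the epigraph;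
  expanding the squared norm of the combination moves the quadratic to the right-hand side.
\<close>
lemma strongly_convex_fun_ineq:
  fixes h :: "'a::real_inner \<Rightarrow> ereal"
  assumes sc: "strongly_convex_fun \<mu> h" and proper: "proper_fun h"
    and p: "p \<in> effective_dom h" and u: "u \<in> effective_dom h" and s: "0 \<le> s" "s \<le> 1"
  shows "(1 - s) *\<^sub>R p + s *\<^sub>R u \<in> effective_dom h" (is "?z \<in> _")
    and "real_of_ereal (h ((1 - s) *\<^sub>R p + s *\<^sub>R u))
      \<le> (1 - s) * real_of_ereal (h p) + s * real_of_ereal (h u)
        - \<mu> / 2 * (s * (1 - s) * (norm (u - p))\<^sup>2)"
proof -
  obtain a where a: "h p = ereal a"
    using p by (auto simp: effective_dom_def)
  obtain b where b: "h u = ereal b"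
    using u by (auto simp: effective_dom_def)
  let ?E = "ereal_epigraph (\<lambda>x. h x - ereal (\<mu> / 2 * (norm x)\<^sup>2))"
  have "convex ?E"
    using sc by (simp add: strongly_convex_fun_def convex_fun_def)
  moreover have "(p, a - \<mu> / 2 * (norm p)\<^sup>2) \<in> ?E" "(u, b - \<mu> / 2 * (norm u)\<^sup>2) \<in> ?E"
    by (simp_all add: ereal_epigraph_def a b)
  ultimately have "(1 - s) *\<^sub>R (p, a - \<mu> / 2 * (norm p)\<^sup>2)
      + s *\<^sub>R (u, b - \<mu> / 2 * (norm u)\<^sup>2) \<in> ?E"
    using s by (intro convexD) auto
  then have le: "h ?z - ereal (\<mu> / 2 * (norm ?z)\<^sup>2)
      \<le> ereal ((1 - s) * (a - \<mu> / 2 * (norm p)\<^sup>2) + s * (b - \<mu> / 2 * (norm u)\<^sup>2))"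
    by (simp add: ereal_epigraph_def)
  have "h ?z \<noteq> -\<infinity>"
    using proper by (simp add: proper_fun_def)
  then obtain c where c: "h ?z = ereal c"
    using le by (cases "h ?z") auto
  then show "?z \<in> effective_dom h"
    by (simp add: effective_dom_def)
  have "c - \<mu> / 2 * (norm ?z)\<^sup>2
      \<le> (1 - s) * (a - \<mu> / 2 * (norm p)\<^sup>2) + s * (b - \<mu> / 2 * (norm u)\<^sup>2)"
    using le unfolding c by simp
  then have "c \<le> (1 - s) * a + s * b
      + \<mu> / 2 * ((norm ?z)\<^sup>2 - (1 - s) * (norm p)\<^sup>2 - s * (norm u)\<^sup>2)"
    by (simp add: algebra_simps diff_divide_distrib)
  then show "real_of_ereal (h ?z) \<le> (1 - s) * real_of_ereal (h p) + s * real_of_ereal (h u)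
      - \<mu> / 2 * (s * (1 - s) * (norm (u - p))\<^sup>2)"
    by (simp add: a b c norm_convex_combination_sq)
qed

lemma strongly_convex_fun_convex_on:
  fixes h :: "'a::real_inner \<Rightarrow> ereal"
  assumes sc: "strongly_convex_fun \<mu> h" and proper: "proper_fun h"
  shows "convex_on (effective_dom h) (\<lambda>x. real_of_ereal (h x))"
proof (rule convex_onI)
  fix t :: real and p u
  assume t: "0 < t" "t < 1" and pu: "p \<in> effective_dom h" "u \<in> effective_dom h"
  have "0 \<le> \<mu> / 2 * (t * (1 - t) * (norm (u - p))\<^sup>2)"
    using sc t by (simp add: strongly_convex_fun_def)
  then show "real_of_ereal (h ((1 - t) *\<^sub>R p + t *\<^sub>R u))
      \<le> (1 - t) * real_of_ereal (h p) + t * real_of_ereal (h u)"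
    using strongly_convex_fun_ineq(2)[OF sc proper pu, of t] t by linarith
next
  show "convex (effective_dom h)"
    using strongly_convex_fun_ineq(1)[OF sc proper] by (auto simp: convex_alt)
qed

text \<open>
  This is the optimality inequality behind both proximal steps. The hypothesis on \<open>q\<close> says that it is
  quadratic with curvature \<open>c\<close> along the segments leaving \<open>p\<close>, so \<open>h + q\<close> satisfies there
  the strong convexity inequality with parameter \<open>c + \<mu>\<close>. Comparing the minimiser \<open>p\<close> with the point \<open>(1 - s) p + s u\<close>, dividing by
  \<open>s\<close> and letting \<open>s\<close> tend to \<open>0\<close> gives quadratic growth away from \<open>p\<close>.
\<close>
lemma arg_min_quadratic_perturbation:
  fixes h :: "'a::real_inner \<Rightarrow> ereal"
  assumes sc: "strongly_convex_fun \<mu> h" and proper: "proper_fun h"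
    and min: "is_arg_min (\<lambda>v. h v + ereal (q v)) (\<lambda>_. True) p"
    and q: "\<And>u s. q ((1 - s) *\<^sub>R p + s *\<^sub>R u)
              = (1 - s) * q p + s * q u - c / 2 * (s * (1 - s) * (norm (u - p))\<^sup>2)"
  shows "p \<in> effective_dom h"
    and "u \<in> effective_dom h \<Longrightarrow>
      real_of_ereal (h p) + q p + (c + \<mu>) / 2 * (norm (u - p))\<^sup>2 \<le> real_of_ereal (h u) + q u"
proof -
  have least: "h p + ereal (q p) \<le> h v + ereal (q v)" for v
    using min by (auto simp: is_arg_min_def not_less)
  obtain v where v: "h v \<noteq> \<infinity>"
    using proper by (auto simp: proper_fun_def)
  have "h p \<noteq> -\<infinity>" "h v \<noteq> -\<infinity>"
    using proper by (simp_all add: proper_fun_def)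
  then show p: "p \<in> effective_dom h"
    using least[of v] v by (cases "h p"; cases "h v") (auto simp: effective_dom_def)
  assume u: "u \<in> effective_dom h"
  let ?h = "\<lambda>x. real_of_ereal (h x)" and ?D = "(c + \<mu>) / 2 * (norm (u - p))\<^sup>2"
  \<comment> \<open>Here \<open>r = 1 - s\<close>, so that the limit \<open>s \<rightarrow> 0\<close> becomes the limit \<open>r \<rightarrow> 1\<close> of
    \<open>field_le_mult_one_interval\<close>.\<close>
  have "r * ?D \<le> (?h u + q u) - (?h p + q p)" if r: "0 < r" "r < 1" for r
  proof -
    define s where "s = 1 - r"
    have s: "0 < s" "s < 1"
      using r by (simp_all add: s_def)
    let ?z = "(1 - s) *\<^sub>R p + s *\<^sub>R u"
    have "?z \<in> effective_dom h"
      using strongly_convex_fun_ineq(1)[OF sc proper p u] s by simp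
    then have "?h p + q p \<le> ?h ?z + q ?z"
      using least[of ?z] p by (cases "h p"; cases "h ?z") (auto simp: effective_dom_def)
    also have "\<dots> \<le> (1 - s) * (?h p + q p) + s * (?h u + q u) - s * ((1 - s) * ?D)"
      using strongly_convex_fun_ineq(2)[OF sc proper p u, of s] q[of s u] s
      by (simp add: field_simps)
    finally have "s * ((1 - s) * ?D) \<le> s * ((?h u + q u) - (?h p + q p))"
      by (simp add: algebra_simps)
    then have "(1 - s) * ?D \<le> (?h u + q u) - (?h p + q p)"
      using s by (simp only: mult_le_cancel_left_pos)
    then show ?thesis
      by (simp add: s_def)
  qed
  then have "?D \<le> (?h u + q u) - (?h p + q p)"
    by (rule field_le_mult_one_interval)
  then show "?h p + q p + ?D \<le> ?h u + q u"
    by simp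
qed

section \<open>The quadratic terms of the proximal steps\<close>

lemma prox_quadratic:
  fixes p u z :: "'a::real_inner"
  shows "1 / (2 * \<tau>) * (norm (((1 - s) *\<^sub>R p + s *\<^sub>R u) - z))\<^sup>2
    = (1 - s) * (1 / (2 * \<tau>) * (norm (p - z))\<^sup>2) + s * (1 / (2 * \<tau>) * (norm (u - z))\<^sup>2)
      - 1 / \<tau> / 2 * (s * (1 - s) * (norm (u - p))\<^sup>2)"
proof -
  have "((1 - s) *\<^sub>R p + s *\<^sub>R u) - z = (1 - s) *\<^sub>R (p - z) + s *\<^sub>R (u - z)"
    by (simp add: algebra_simps)
  then have shifted: "(norm (((1 - s) *\<^sub>R p + s *\<^sub>R u) - z))\<^sup>2
      = (1 - s) * (norm (p - z))\<^sup>2 + s * (norm (u - z))\<^sup>2 - s * (1 - s) * (norm (u - p))\<^sup>2"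
    using norm_convex_combination_sq[of s "p - z" "u - z"] by simp
  show ?thesis
    unfolding shifted by (simp add: algebra_simps add_divide_distrib diff_divide_distrib)
qed

lemma prox_primal_quadratic:
  fixes A :: "real^'n^'m"
  shows "(A *v ((1 - s) *\<^sub>R p + s *\<^sub>R u)) \<bullet> w
      + 1 / (2 * \<eta>) * (norm (((1 - s) *\<^sub>R p + s *\<^sub>R u) - z))\<^sup>2
    = (1 - s) * ((A *v p) \<bullet> w + 1 / (2 * \<eta>) * (norm (p - z))\<^sup>2)
      + s * ((A *v u) \<bullet> w + 1 / (2 * \<eta>) * (norm (u - z))\<^sup>2)
      - 1 / \<eta> / 2 * (s * (1 - s) * (norm (u - p))\<^sup>2)"
  unfolding prox_quadratic
  by (simp add: matrix_vector_right_distrib matrix_vector_mult_scaleR inner_left_distrib distrib_left)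

text \<open>
  Up to a constant, the dual step minimises \<open>g\<close> minus a linear term plus a proximal term centred at the
  current iterate.
\<close>
lemma prox_dual_expand:
  fixes v w z :: "'a::real_inner"
  assumes "0 < \<tau>"
  shows "1 / (2 * \<tau>) * (norm (v - (z + \<tau> *\<^sub>R w)))\<^sup>2
    = 1 / \<tau> / 2 * (norm (v - z))\<^sup>2 - w \<bullet> v + (w \<bullet> z + \<tau> / 2 * (norm w)\<^sup>2)"
proof -
  have "(norm (v - (z + \<tau> *\<^sub>R w)))\<^sup>2 = (norm (v - z))\<^sup>2 + \<tau> * (2 * (w \<bullet> z) - 2 * (w \<bullet> v) + \<tau> * (norm w)\<^sup>2)"
    by (simp add: power2_norm_eq_inner inner_simps inner_commute algebra_simps)
  then show ?thesis
    using assms by (simp add: field_simps)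
qed

section \<open>The potential and its decrease\<close>

text \<open>
  \<open>(xt, yt)\<close> is the iterate number \<open>t\<close>, \<open>d\<close> its dual increment and \<open>(x, y)\<close> the comparison point. The
  bilinear term is the boundary term of the telescoping sum produced by the extrapolation. The square
  of \<open>d\<close> is what the dual step of the previous iteration gained; it is stored here because the coupling
  error that it has to absorb only appears one iteration later.
\<close>
definition edpd_potential ::
  "real^'n^'m \<Rightarrow> real \<Rightarrow> real^'n \<Rightarrow> real^'m \<Rightarrow> real \<Rightarrow> real^'n \<Rightarrow> real^'m \<Rightarrow> real^'m \<Rightarrow> real" where
  "edpd_potential A \<tau> x y t xt yt d =
     (onorm ((*v) A))\<^sup>2 * \<tau> / 2 * (norm (x - xt))\<^sup>2 + (t + 1)\<^sup>2 / (2 * \<tau>) * (norm (y - yt))\<^sup>2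
     + t\<^sup>2 / (2 * \<tau>) * (norm d)\<^sup>2 - t * ((A *v (xt - x)) \<bullet> d)"

text \<open>
  Cauchy-Schwarz and Young's inequality, balanced so that the two squares come with the coefficients
  that they have in the potential.
\<close>
lemma coupling_le_squares:
  fixes A :: "real^'n^'m"
  assumes \<tau>: "0 < \<tau>" and t: "0 \<le> t"
  shows "t * \<bar>(A *v u) \<bullet> d\<bar>
    \<le> (onorm ((*v) A))\<^sup>2 * \<tau> / 2 * (norm u)\<^sup>2 + t\<^sup>2 / (2 * \<tau>) * (norm d)\<^sup>2"
proof -
  let ?N = "onorm ((*v) A)"
  have "\<bar>(A *v u) \<bullet> d\<bar> \<le> norm (A *v u) * norm d"
    by (rule Cauchy_Schwarz_ineq2)
  also have "\<dots> \<le> (?N * norm u) * norm d"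
    using onorm[OF matrix_vector_mul_bounded_linear, of A u] by (intro mult_right_mono) auto
  finally have "t * \<bar>(A *v u) \<bullet> d\<bar> \<le> (?N * norm u) * (t * norm d)"
    using t by (metis mult.left_commute mult_left_mono)
  also have "\<dots> = (?N * norm u * \<tau>) * (t * norm d) / \<tau>"
    using \<tau> by simp
  also have "\<dots> \<le> ((?N * norm u * \<tau>)\<^sup>2 + (t * norm d)\<^sup>2) / 2 / \<tau>"
    using \<tau> sum_squares_bound[of "?N * norm u * \<tau>" "t * norm d"] 
    by (intro divide_right_mono) auto
  also have "\<dots> = ?N\<^sup>2 * \<tau> / 2 * (norm u)\<^sup>2 + t\<^sup>2 / (2 * \<tau>) * (norm d)\<^sup>2"
    using \<tau> by (simp add: field_simps power2_eq_square)
  finally show ?thesis .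
qed

text \<open>
  The bilinear term is dominated by the first and the third square, hence the potential is at least
  its \<open>y\<close>-distance term.
\<close>
lemma edpd_potential_nonneg:
  assumes "0 < \<tau>" "0 \<le> t"
  shows "0 \<le> edpd_potential A \<tau> x y t xt yt d"
proof -
  have "0 \<le> (t + 1)\<^sup>2 / (2 * \<tau>) * (norm (y - yt))\<^sup>2"
    using assms by simp
  moreover have "t * ((A *v (xt - x)) \<bullet> d) \<le> t * \<bar>(A *v (xt - x)) \<bullet> d\<bar>"
    using assms by (intro mult_left_mono) auto
  ultimately show ?thesis
    using coupling_le_squares[OF assms, of A "xt - x" d]
    by (simp add: edpd_potential_def norm_minus_commute)
qed

text \<open>
  One iteration. The hypotheses \<open>primal\<close> and \<open>dual\<close> are the optimality inequalities of the two steps,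
  and \<open>w\<close> is the extrapolated dual point; \<open>t\<close> on the right-hand side of its equation is the
  weight of the preceding gap, which is what makes the bilinear terms telescope.
\<close>
lemma edpd_gap_le_potential_drop:
  fixes A :: "real^'n^'m"
  assumes \<tau>: "0 < \<tau>" and t: "1 \<le> t" and \<mu>: "\<mu> = 2.5 / \<tau>"
    and primal: "fn + (A *v xn) \<bullet> w + c / 2 * (norm (xn - xt))\<^sup>2 + c / 2 * (norm (x - xn))\<^sup>2
        \<le> fx + (A *v x) \<bullet> w + c / 2 * (norm (x - xt))\<^sup>2"
    and c: "c = (onorm ((*v) A))\<^sup>2 * \<tau> / (t + 1)"
    and dual: "gn - (A *v xn) \<bullet> yn + e / 2 * (norm (yn - yt))\<^sup>2 + (e + \<mu>) / 2 * (norm (y - yn))\<^sup>2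
        \<le> gy - (A *v xn) \<bullet> y + e / 2 * (norm (y - yt))\<^sup>2"
    and e: "e = (t + 1) / \<tau>"
    and w: "(t + 1) *\<^sub>R (w - yt) = t *\<^sub>R d"
  shows "(t + 1) * ((fn + (A *v xn) \<bullet> y - gy) - (fx + (A *v x) \<bullet> yn - gn))
    \<le> edpd_potential A \<tau> x y t xt yt d - edpd_potential A \<tau> x y (t + 1) xn yn (yn - yt)"
proof -
  let ?K = "(onorm ((*v) A))\<^sup>2 * \<tau> / 2" and ?B = "A *v (xn - x)"
  have "(fn + (A *v xn) \<bullet> y - gy) - (fx + (A *v x) \<bullet> yn - gn)
      \<le> ?B \<bullet> (yn - yt) - ?B \<bullet> (w - yt)
        + c / 2 * ((norm (x - xt))\<^sup>2 - (norm (xn - xt))\<^sup>2 - (norm (x - xn))\<^sup>2)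
        + (e / 2 * (norm (y - yt))\<^sup>2 - e / 2 * (norm (yn - yt))\<^sup>2 - (e + \<mu>) / 2 * (norm (y - yn))\<^sup>2)"
    using primal dual by (simp add: matrix_vector_mult_diff_distrib inner_simps algebra_simps)
  then have "(t + 1) * ((fn + (A *v xn) \<bullet> y - gy) - (fx + (A *v x) \<bullet> yn - gn))
      \<le> (t + 1) * (?B \<bullet> (yn - yt) - ?B \<bullet> (w - yt)
        + c / 2 * ((norm (x - xt))\<^sup>2 - (norm (xn - xt))\<^sup>2 - (norm (x - xn))\<^sup>2)
        + (e / 2 * (norm (y - yt))\<^sup>2 - e / 2 * (norm (yn - yt))\<^sup>2 - (e + \<mu>) / 2 * (norm (y - yn))\<^sup>2))"
    using t by (intro mult_left_mono) auto
  also have "\<dots> = (t + 1) * (?B \<bullet> (yn - yt)) - ?B \<bullet> ((t + 1) *\<^sub>R (w - yt))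
        + ((t + 1) * c) / 2 * ((norm (x - xt))\<^sup>2 - (norm (xn - xt))\<^sup>2 - (norm (x - xn))\<^sup>2)
        + ((t + 1) * e / 2 * (norm (y - yt))\<^sup>2 - (t + 1) * e / 2 * (norm (yn - yt))\<^sup>2
        - (t + 1) * (e + \<mu>) / 2 * (norm (y - yn))\<^sup>2)"
    by (simp add: algebra_simps)
  finally have gap: "(t + 1) * ((fn + (A *v xn) \<bullet> y - gy) - (fx + (A *v x) \<bullet> yn - gn)) \<le> \<dots>" .
  have scale_c: "(t + 1) * c / 2 = ?K" and scale_e: "(t + 1) * e / 2 = (t + 1)\<^sup>2 / (2 * \<tau>)"
    using t \<tau> by (simp_all add: c e power2_eq_square)
  \<comment> \<open>Strong convexity pays for the growth of the dual weight: \<open>2 t + 3 \<le> 2.5 (t + 1)\<close> for \<open>t \<ge> 1\<close>.\<close>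
  have "(t + 2)\<^sup>2 / (2 * \<tau>) \<le> ((t + 1)\<^sup>2 + 2.5 * (t + 1)) / (2 * \<tau>)"
    using t \<tau> by (intro divide_right_mono) (auto simp: power2_eq_square algebra_simps)
  also have "\<dots> = (t + 1) * (e + \<mu>) / 2"
    using t \<tau> by (simp add: e \<mu> field_simps power2_eq_square)
  finally have growth: "(t + 2)\<^sup>2 / (2 * \<tau>) * (norm (y - yn))\<^sup>2 \<le> (t + 1) * (e + \<mu>) / 2 * (norm (y - yn))\<^sup>2"
    by (rule mult_right_mono) simp
  \<comment> \<open>The bilinear term is taken at \<open>xn\<close> but telescoping needs it at \<open>xt\<close>; Young's inequality bounds
    the difference.\<close>
  have "t * (- ((A *v (xn - xt)) \<bullet> d)) \<le> t * \<bar>(A *v (xn - xt)) \<bullet> d\<bar>"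
    using t by (intro mult_left_mono) auto
  also have "\<dots> \<le> ?K * (norm (xn - xt))\<^sup>2 + t\<^sup>2 / (2 * \<tau>) * (norm d)\<^sup>2"
    using coupling_le_squares[OF \<tau>, of t A] t by simp
  finally have "- t * (?B \<bullet> d)
      \<le> ?K * (norm (xn - xt))\<^sup>2 + t\<^sup>2 / (2 * \<tau>) * (norm d)\<^sup>2 - t * ((A *v (xt - x)) \<bullet> d)"
    by (simp add: matrix_vector_mult_diff_distrib inner_simps algebra_simps)
  then show ?thesis
    using gap growth unfolding w scale_c scale_e
    by (simp add: edpd_potential_def add.assoc right_diff_distrib)
qed

section \<open>Weighted means of the iterates\<close>

lemma sum_ergodic_weights: "(\<Sum>t=1..k. (real t + 1)) = real k * (real k + 3) / 2"
  by (induction k) (auto simp: algebra_simps)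

lemma ergodic_mean_Jensen:
  assumes conv: "convex_on C h" and k: "1 \<le> k" and z: "\<And>t. 1 \<le> t \<Longrightarrow> z (t + 1) \<in> C"
  shows "ergodic_mean z k \<in> C"
    and "(\<Sum>t=1..k. (real t + 1)) * h (ergodic_mean z k) \<le> (\<Sum>t=1..k. (real t + 1) * h (z (t + 1)))"
proof -
  define W where "W = (\<Sum>t=1..k. (real t + 1))"
  have W: "0 < W"
    using k unfolding W_def sum_ergodic_weights by simp
  have mean: "ergodic_mean z k = (\<Sum>t=1..k. ((real t + 1) / W) *\<^sub>R z (t + 1))"
    unfolding ergodic_mean_def W_def[symmetric]
    by (simp add: scaleR_sum_right divide_inverse mult.commute)
  have one: "(\<Sum>t=1..k. (real t + 1) / W) = 1"
    unfolding sum_divide_distrib[symmetric] W_def[symmetric] using W by simp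
  have z': "z (t + 1) \<in> C" if "t \<in> {1..k}" for t
    using z that by simp
  have "convex C"
    using conv by (rule convex_on_imp_convex)
  then show "ergodic_mean z k \<in> C"
    unfolding mean using z' W one by (intro convex_sum) auto
  have "h (ergodic_mean z k) \<le> (\<Sum>t=1..k. (real t + 1) / W * h (z (t + 1)))"
    unfolding mean using z' W one k by (intro convex_on_sum[OF _ _ conv]) auto
  also have "\<dots> = (\<Sum>t=1..k. (real t + 1) * h (z (t + 1))) / W"
    by (simp add: sum_divide_distrib)
  finally show "(\<Sum>t=1..k. (real t + 1)) * h (ergodic_mean z k) \<le> (\<Sum>t=1..k. (real t + 1) * h (z (t + 1)))"
    using W unfolding W_def[symmetric] by (simp add: pos_le_divide_eq mult.commute)
qed

lemma ergodic_mean_linear: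
  assumes "linear l" and k: "1 \<le> k"
  shows "(\<Sum>t=1..k. (real t + 1)) * (l (ergodic_mean z k)) = (\<Sum>t=1..k. (real t + 1) * (l (z (t + 1)) :: real))"
proof -
  define W where "W = (\<Sum>t=1..k. (real t + 1))"
  have "W \<noteq> 0"
    using k unfolding W_def sum_ergodic_weights by simp
  then show ?thesis
    using assms(1) unfolding ergodic_mean_def W_def[symmetric]
    by (simp add: linear_scale linear_sum mult.assoc[symmetric])
qed

section \<open>Convergence rate of the ergodic gap\<close>

theorem theorem4p2:
  fixes f :: "real^'n \<Rightarrow> ereal" and g :: "real^'m \<Rightarrow> ereal"
    and A :: "real^'n^'m"
    and \<mu>g \<tau> :: real
    and \<alpha> \<tau>s \<eta>s :: "nat \<Rightarrow> real"
    and xs :: "nat \<Rightarrow> real^'n" and ys yh :: "nat \<Rightarrow> real^'m"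
    and k :: nat and x :: "real^'n" and y :: "real^'m"
  assumes f: "proper_fun f" "closed_fun f" "convex_fun f"
    and g: "proper_fun g" "closed_fun g" "0 < \<mu>g" "strongly_convex_fun \<mu>g g"
    and A: "A \<noteq> 0"
    and tau: "\<tau> = 2.5 / \<mu>g"
    and alphas: "\<And>t. t \<ge> 1 \<Longrightarrow> \<alpha> (t + 1) = (real t + 1) / (real t + 2)"
    and taus: "\<And>t. t \<ge> 1 \<Longrightarrow> \<tau>s t = \<tau> / (real t + 1)"
    and etas: "\<And>t. t \<ge> 1 \<Longrightarrow> \<eta>s t = (real t + 1) / (\<tau> * (onorm ((*v) A))\<^sup>2)"
    and edpd: "EDPD f g A \<alpha> \<tau>s \<eta>s xs ys yh"
    and k: "k \<ge> 1"
    and x: "x \<in> effective_dom f" and y: "y \<in> effective_dom g"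
  shows "saddle_fun f g A (ergodic_mean xs k) y - saddle_fun f g A x (ergodic_mean ys k)
    \<le> ereal (2 / (real k * (real k + 3)) *
        ((onorm ((*v) A))\<^sup>2 * \<tau> / 2 * (norm (x - xs 1))\<^sup>2 + 2 / \<tau> * (norm (y - ys 1))\<^sup>2))"
proof -
  let ?N = "onorm ((*v) A)"
  let ?f = "\<lambda>u. real_of_ereal (f u)" and ?g = "\<lambda>v. real_of_ereal (g v)"
  let ?xm = "ergodic_mean xs k" and ?ym = "ergodic_mean ys k"
  define W where "W = (\<Sum>t=1..k. (real t + 1))"
  define \<Phi> where "\<Phi> t = edpd_potential A \<tau> x y (real t) (xs t) (ys t) (ys t - ys (t - 1))" for t
  define gap where "gap t = (?f (xs (t + 1)) + (A *v xs (t + 1)) \<bullet> y - ?g y)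
    - (?f x + (A *v x) \<bullet> ys (t + 1) - ?g (ys (t + 1)))" for t
  have \<tau>: "0 < \<tau>"
    using g(3) tau by simp
  have f_sc: "strongly_convex_fun 0 f"
    using f(3) by (simp add: strongly_convex_fun_def zero_ereal_def[symmetric])
  have y0: "ys 0 = ys 1" "yh 1 = ys 1"
    using edpd by (auto simp: EDPD_def)
  have step: "xs (t + 1) \<in> effective_dom f \<and> ys (t + 1) \<in> effective_dom g
      \<and> (real t + 1) * gap t \<le> \<Phi> t - \<Phi> (t + 1)" if t: "1 \<le> t" for t
  proof -
    have pos: "0 < \<tau>s t" "0 < \<eta>s t"
      and min_x: "is_arg_min (\<lambda>u. f u + ereal ((A *v u) \<bullet> yh t + 1 / (2 * \<eta>s t) * (norm (u - xs t))\<^sup>2))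
        (\<lambda>_. True) (xs (t + 1))"
      and min_y: "is_arg_min
        (\<lambda>v. g v + ereal (1 / (2 * \<tau>s t) * (norm (v - (ys t + \<tau>s t *\<^sub>R (A *v xs (t + 1)))))\<^sup>2))
        (\<lambda>_. True) (ys (t + 1))"
      using edpd t by (auto simp: EDPD_def add.assoc add.commute[of "ereal _" "g _"])
    note prox_x = arg_min_quadratic_perturbation[OF f_sc f(1) min_x, where c = "1 / \<eta>s t",
        OF prox_primal_quadratic]
    note prox_y = arg_min_quadratic_perturbation[OF g(4) g(1) min_y, where c = "1 / \<tau>s t",
        OF prox_quadratic]
    \<comment> \<open>For \<open>t > 1\<close> this is \<open>(t + 1) \<alpha>\<^sub>t = t\<close>; for \<open>t = 1\<close> both sides vanish.\<close>
    have ext: "(real t + 1) *\<^sub>R (yh t - ys t) = real t *\<^sub>R (ys t - ys (t - 1))"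
    proof (cases "t = 1")
      case True
      then show ?thesis using y0 by simp
    next
      case False
      then obtain r where r: "t = r + 1" "1 \<le> r"
        using t that[of "t - 1"] by simp
      have "yh t = ys t + \<alpha> t *\<^sub>R (ys t - ys r)"
        using edpd r by (auto simp: EDPD_def)
      moreover have "\<alpha> t = real t / (real t + 1)"
        using alphas[OF r(2)] r by (simp add: add.commute)
      ultimately show ?thesis
        using r by (simp add: add_eq_0_iff)
    qed
    have "(real t + 1) * gap t \<le> edpd_potential A \<tau> x y (real t) (xs t) (ys t) (ys t - ys (t - 1))
      - edpd_potential A \<tau> x y (real t + 1) (xs (t + 1)) (ys (t + 1)) (ys (t + 1) - ys t)"
      unfolding gap_def
    proof (rule edpd_gap_le_potential_drop[OF \<tau> _ _ _ _ _ _ ext])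
      show "\<mu>g = 2.5 / \<tau>"
        using g(3) by (simp add: tau)
      show "?f (xs (t + 1)) + (A *v xs (t + 1)) \<bullet> yh t + 1 / \<eta>s t / 2 * (norm (xs (t + 1) - xs t))\<^sup>2
          + 1 / \<eta>s t / 2 * (norm (x - xs (t + 1)))\<^sup>2
        \<le> ?f x + (A *v x) \<bullet> yh t + 1 / \<eta>s t / 2 * (norm (x - xs t))\<^sup>2"
        using prox_x(2)[OF x] by (simp add: algebra_simps)
      show "?g (ys (t + 1)) - (A *v xs (t + 1)) \<bullet> ys (t + 1)
          + 1 / \<tau>s t / 2 * (norm (ys (t + 1) - ys t))\<^sup>2
          + (1 / \<tau>s t + \<mu>g) / 2 * (norm (y - ys (t + 1)))\<^sup>2
        \<le> ?g y - (A *v xs (t + 1)) \<bullet> y + 1 / \<tau>s t / 2 * (norm (y - ys t))\<^sup>2"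
        using prox_y(2)[OF y] unfolding prox_dual_expand[OF pos(1)] by simp
      show "1 / \<eta>s t = ?N\<^sup>2 * \<tau> / (real t + 1)" "1 / \<tau>s t = (real t + 1) / \<tau>"
        by (simp_all add: etas[OF t] taus[OF t])
    qed (use t in auto)
    then show ?thesis
      using prox_x(1) prox_y(1) by (simp add: \<Phi>_def add.commute)
  qed

  have "(\<Sum>t=1..k. (real t + 1) * gap t) \<le> (\<Sum>t=1..k. \<Phi> t - \<Phi> (t + 1))"
    using step by (intro sum_mono) simp
  also have "\<dots> = \<Phi> 1 - \<Phi> (k + 1)"
    by (induction k) auto
  also have "\<dots> \<le> \<Phi> 1"
    using \<tau> by (simp add: \<Phi>_def edpd_potential_nonneg)
  also have "\<Phi> 1 = ?N\<^sup>2 * \<tau> / 2 * (norm (x - xs 1))\<^sup>2 + 2 / \<tau> * (norm (y - ys 1))\<^sup>2"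
    by (simp add: \<Phi>_def edpd_potential_def y0)
  finally have total: "(\<Sum>t=1..k. (real t + 1) * gap t) \<le> \<dots>" .

  note Jx = ergodic_mean_Jensen[OF strongly_convex_fun_convex_on[OF f_sc f(1)] k, of xs]
  note Jy = ergodic_mean_Jensen[OF strongly_convex_fun_convex_on[OF g(4) g(1)] k, of ys]
  have Jensen_f: "W * ?f ?xm \<le> (\<Sum>t=1..k. (real t + 1) * ?f (xs (t + 1)))"
    unfolding W_def using step by (intro Jx(2)) simp
  have Jensen_g: "W * ?g ?ym \<le> (\<Sum>t=1..k. (real t + 1) * ?g (ys (t + 1)))"
    unfolding W_def using step by (intro Jy(2)) simp
  have sum_gap: "(\<Sum>t=1..k. (real t + 1) * gap t)
      = (\<Sum>t=1..k. (real t + 1) * ?f (xs (t + 1)))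
        + (\<Sum>t=1..k. (real t + 1) * ((A *v xs (t + 1)) \<bullet> y)) - W * ?g y - W * ?f x
        - (\<Sum>t=1..k. (real t + 1) * ((A *v x) \<bullet> ys (t + 1)))
        + (\<Sum>t=1..k. (real t + 1) * ?g (ys (t + 1)))"
    unfolding W_def gap_def sum_distrib_right sum.distrib[symmetric] sum_subtractf[symmetric]
    by (intro sum.cong) (simp_all add: algebra_simps)
  have mem: "?xm \<in> effective_dom f" "?ym \<in> effective_dom g"
    using step Jx(1) Jy(1) by auto
  have lin_x: "W * ((A *v ?xm) \<bullet> y) = (\<Sum>t=1..k. (real t + 1) * ((A *v xs (t + 1)) \<bullet> y))"
    unfolding W_def
    by (rule ergodic_mean_linear[OF _ k])
      (intro linearI; simp add: matrix_vector_right_distrib matrix_vector_mult_scaleR inner_left_distrib)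
  have lin_y: "W * ((A *v x) \<bullet> ?ym) = (\<Sum>t=1..k. (real t + 1) * ((A *v x) \<bullet> ys (t + 1)))"
    unfolding W_def by (rule ergodic_mean_linear[OF _ k]) (intro linearI; simp add: inner_right_distrib)
  have "W * ((?f ?xm + (A *v ?xm) \<bullet> y - ?g y) - (?f x + (A *v x) \<bullet> ?ym - ?g ?ym))
      = W * ?f ?xm + W * ((A *v ?xm) \<bullet> y) - W * ?g y - W * ?f x - W * ((A *v x) \<bullet> ?ym) + W * ?g ?ym"
    by (simp add: algebra_simps)
  also have "\<dots> \<le> (\<Sum>t=1..k. (real t + 1) * gap t)"
    unfolding sum_gap lin_x lin_y using Jensen_f Jensen_g by linarith
  finally have "W * ((?f ?xm + (A *v ?xm) \<bullet> y - ?g y) - (?f x + (A *v x) \<bullet> ?ym - ?g ?ym))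
      \<le> ?N\<^sup>2 * \<tau> / 2 * (norm (x - xs 1))\<^sup>2 + 2 / \<tau> * (norm (y - ys 1))\<^sup>2"
    using total by linarith
  moreover have "W = real k * (real k + 3) / 2"
    unfolding W_def by (rule sum_ergodic_weights)
  ultimately have "(?f ?xm + (A *v ?xm) \<bullet> y - ?g y) - (?f x + (A *v x) \<bullet> ?ym - ?g ?ym)
      \<le> 2 / (real k * (real k + 3)) *
        (?N\<^sup>2 * \<tau> / 2 * (norm (x - xs 1))\<^sup>2 + 2 / \<tau> * (norm (y - ys 1))\<^sup>2)"
    using k by (simp add: pos_le_divide_eq mult.commute)
  moreover have "saddle_fun f g A ?xm y - saddle_fun f g A x ?ym
      = ereal ((?f ?xm + (A *v ?xm) \<bullet> y - ?g y) - (?f x + (A *v x) \<bullet> ?ym - ?g ?ym))"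
    using mem x y by (auto simp: saddle_fun_def effective_dom_def)
  ultimately show ?thesis
    by simp
qed

end
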